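(* Let $\mathbb{K}$ be a number field with ring of integers $\mathcal{O}_{\mathbb{K}}$, let $d\ge 1$, and let $A \in \mathsf{M}_d(\mathbb{K})$ with $\operatorname{pdet} A \in \mathcal{O}_{\mathbb{K}}^{\times}$. Let $T = A^2\hat{A}$. Then $\mathcal{S}_{\mathbb{K}}(A) \subseteq \mathcal{S}_{\mathbb{K}}(T)$.
   Context: $\mathsf{M}_d(R)$ denotes the set of $d\times d$ matrices with entries in $R$, and $\mathcal{O}_{\mathbb{K}}^{\times}$ is the group of units of $\mathcal{O}_{\mathbb{K}}$. For $A \in \mathsf{M}_d(\mathbb{K})$, the exponent semigroup is $\mathcal{S}_{\mathbb{K}}(A)=\{n\in\mathbb{Z}_{\geq 0} : A^n\in\mathsf{M}_d(\mathcal{O}_{\mathbb{K}})\}$. The pseudo-determinant $\operatorname{pdet} A$ is the product of the nonzero eigenvalues of $A$, counted with algebraic multiplicity (it equals $1$ if $A$ is nilpotent); it lies in $\mathbb{K}$. The index $\operatorname{ind} A$ is $0$ if $A$ is invertible, and otherwise the least positive integer $k$ with $\operatorname{rank} A^k = \operatorname{rank} A^{k+1}$. The Drazin inverse $\hat{A}\in \mathsf{M}_d(\mathbb{K})$ of $A$ is the unique matrix satisfying $A\hat{A}A^k = A^k$, $A\hat{A}=\hat{A}A$, and $\hat{A}A\hat{A}=\hat{A}$, where $k=\operatorname{ind} A$ (so $\hat{A}=A^{-1}$ if $A$ is invertible). *)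

theory Defs
  imports
    "HOL-Algebra.Algebraic_Closure_Type"
    "Jordan_Normal_Form.Char_Poly"
    "Jordan_Normal_Form.DL_Rank"
begin

text \<open>A number field is a field of characteristic 0 (hence containing \<open>\<rat>\<close> via
  \<^const>\<open>of_rat\<close>) that is finite-dimensional as a vector space over \<open>\<rat>\<close>.\<close>

definition number_field :: "'k::field_char_0 itself \<Rightarrow> bool" where
  "number_field _ \<longleftrightarrow>
     (\<exists>B. finite B \<and> Modules.module.span (\<lambda>(q::rat) (x::'k). of_rat q * x) B = UNIV)"

lemma number_field_rat: "number_field TYPE(rat)"
proof -
  interpret Vector_Spaces.vector_space "\<lambda>(q::rat) (x::rat). of_rat q * x"
    by unfold_locales (auto simp: algebra_simps of_rat_add of_rat_mult)
  have "x \<in> span {1}" for x :: rat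
  proof -
    have "of_rat x * 1 \<in> span {1}"
      by (rule span_scale) (rule span_base, simp)
    then show ?thesis by simp
  qed
  then show ?thesis
    unfolding number_field_def by (intro exI[of _ "{1}"]) auto
qed

definition ring_of_integers :: "'k::field_char_0 set" ("\<O>") where
  "\<O> = {x. algebraic_int x}"

definition integer_units :: "'k::field_char_0 set" ("\<O>\<^sup>\<times>") where
  "\<O>\<^sup>\<times> = {x \<in> \<O>. \<exists>y\<in>\<O>. x * y = 1}"

definition matrices_over :: "nat \<Rightarrow> 'a set \<Rightarrow> 'a mat set" where
  "matrices_over d R = {M \<in> carrier_mat d d. elements_mat M \<subseteq> R}"

definition exponent_semigroup :: "'k::field_char_0 mat \<Rightarrow> nat set" where
  "exponent_semigroup A = {n. A ^\<^sub>m n \<in> matrices_over (dim_row A) \<O>}"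

text \<open>The eigenvalues are taken in the algebraic closure; \<^const>\<open>of_ac\<close> brings their
  product back to the base field. That product always lies in the base field; for an element
  outside it \<^const>\<open>of_ac\<close> would return 0.\<close>

definition pdet :: "'a::field mat \<Rightarrow> 'a" where
  "pdet A = (let B = map_mat to_ac A in
     of_ac (\<Prod>a \<in> {a. eigenvalue B a \<and> a \<noteq> 0}. a ^ Polynomial.order a (char_poly B)))"

definition mat_index :: "'a::field mat \<Rightarrow> nat" where
  "mat_index A = (if invertible_mat A then 0
     else LEAST k. 0 < k \<and>
       vec_space.rank (dim_row A) (A ^\<^sub>m k) = vec_space.rank (dim_row A) (A ^\<^sub>m (k + 1)))"

definition is_drazin_inverse :: "'a::field mat \<Rightarrow> 'a mat \<Rightarrow> bool" where
  "is_drazin_inverse A D \<longleftrightarrow>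
     D \<in> carrier_mat (dim_row A) (dim_row A) \<and>
     A * D * A ^\<^sub>m mat_index A = A ^\<^sub>m mat_index A \<and>
     A * D = D * A \<and>
     D * A * D = D"

definition drazin_inverse :: "'a::field mat \<Rightarrow> 'a mat" where
  "drazin_inverse A = (THE D. is_drazin_inverse A D)"

end

theory Submission
  imports Defs
begin

text \<open>
  Let \<open>D\<close> be the Drazin inverse of \<open>A\<close> and \<open>E = A * D\<close>, the projection onto the part of the
  space where \<open>A\<close> is invertible, along the part where \<open>A\<close> is nilpotent. It is idempotent and
  commutes with \<open>A\<close>, and \<open>T = A * E\<close>, so \<open>T^n = A^n * E\<close> for positive \<open>n\<close>. If \<open>B = A^n\<close> is
  integral, it is therefore enough that \<open>E\<close> is integral.

  To see this, let \<open>c\<close> be the lowest nonzero coefficient of the characteristic polynomial of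
  \<open>B\<close>, in degree \<open>m\<close>. Comparing coefficients in the identity between \<open>x - B\<close>, its adjugate and
  its determinant gives an integral matrix \<open>C\<close> with \<open>(C * B + c) * B^m = 0\<close>
  (\<open>adjugate_annihilates_power\<close>). If \<open>1/c\<close> is an algebraic integer, then \<open>V = -C/c\<close> is integral
  and \<open>B^m = V * B^(m+1)\<close>. Since \<open>E = B^m * R\<close> for some \<open>R\<close>, it follows that
  \<open>E = V^k * B^k * E\<close> for all \<open>k\<close>, and for large \<open>k\<close> the factor \<open>E\<close> is absorbed by \<open>B^k\<close>, so
  \<open>E = V^k * B^k\<close> is integral (\<open>drazin_projection_eq\<close>).

  The hypothesis on the pseudo-determinant makes \<open>1/c\<close> integral. Over the algebraic closure,
  \<open>c\<close> is up to sign the product of the nonzero eigenvalues of \<open>B\<close>. Each of them is \<open>b^n\<close> for a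
  nonzero eigenvalue \<open>b\<close> of \<open>A\<close> (\<open>eigenvalue_pow_imp_eigenvalue\<close>). All eigenvalues of \<open>A\<close>
  are algebraic integers, because their \<open>n\<close>-th powers are eigenvalues of the integral matrix
  \<open>B\<close>; and the nonzero ones multiply to a unit, so each of them has an integral inverse
  (\<open>algebraic_int_inverse_eigenvalue\<close>).

  Two supporting theories are developed on the way: algebraic integers form a ring, and the
  Drazin inverse, given by its defining equations at the index, exists and is unique
  (\<open>is_drazin_inverse_drazin_inverse\<close>).
\<close>

unbundle no Formal_Power_Series.fps_syntax

section \<open>The ring of algebraic integers\<close>

text \<open>
  Integrality is tested on finitely generated additive groups: \<open>x\<close> is an algebraic integer as
  soon as multiplication by \<open>x\<close> maps the \<open>\<int>\<close>-span of some finite set that contains a nonzero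
  element into itself. Sums and products of algebraic integers are then handled at once by
  finding one finite set that works for both.
\<close>

interpretation int_module: Modules.module "\<lambda>(c::int) (x::'a::field_char_0). of_int c * x"
  by unfold_locales (auto simp: algebra_simps)

lemma mult_mem_int_span:
  fixes x y :: "'a::field_char_0"
  assumes "\<And>v. v \<in> V \<Longrightarrow> x * v \<in> int_module.span W" and "y \<in> int_module.span V"
  shows "x * y \<in> int_module.span W"
  using assms(2)
proof (induction rule: int_module.span_induct_alt)
  case base
  show ?case by (simp add: int_module.span_zero)
next
  case (step c v y)
  have "of_int c * (x * v) + x * y \<in> int_module.span W"
    using step assms(1) by (intro int_module.span_add int_module.span_scale) auto
  then show ?case by (simp add: algebra_simps)
qed

text \<open>
  The determinant trick: the generators form an eigenvector, for the eigenvalue \<open>x\<close>, of the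
  integer matrix that describes multiplication by \<open>x\<close>, so \<open>x\<close> is a root of its characteristic
  polynomial.
\<close>

lemma algebraic_int_if_int_span_stable:
  fixes x :: "'a::field_char_0"
  assumes fin: "finite W" and w: "w \<in> W" "w \<noteq> 0"
    and stable: "\<And>w. w \<in> W \<Longrightarrow> x * w \<in> int_module.span W"
  shows "algebraic_int x"
proof -
  obtain ws where ws: "set ws = W" "distinct ws"
    using finite_distinct_list[OF fin] by auto
  define n where "n = length ws"
  have "\<forall>w\<in>W. \<exists>c. x * w = (\<Sum>v\<in>W. of_int (c v) * v)"
    using stable int_module.span_finite[OF fin] by auto
  then obtain c where c: "\<And>w. w \<in> W \<Longrightarrow> x * w = (\<Sum>v\<in>W. of_int (c w v) * v)"
    by (auto dest: bchoice)
  define M :: "int mat" where "M = mat n n (\<lambda>(i, j). c (ws ! i) (ws ! j))"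
  define M' :: "'a mat" where "M' = map_mat of_int M"
  define u where "u = vec n (\<lambda>i. ws ! i)"
  have M: "M \<in> carrier_mat n n" and M': "M' \<in> carrier_mat n n"
    by (auto simp: M_def M'_def)
  have "M' *\<^sub>v u = x \<cdot>\<^sub>v u"
  proof (rule eq_vecI)
    fix i assume "i < dim_vec (x \<cdot>\<^sub>v u)"
    then have i: "i < n" by (simp add: u_def)
    have "(M' *\<^sub>v u) $ i = (\<Sum>j<n. of_int (c (ws ! i) (ws ! j)) * ws ! j)"
      using i by (simp add: M'_def M_def u_def scalar_prod_def atLeast0LessThan)
    also have "\<dots> = (\<Sum>v\<in>W. of_int (c (ws ! i) v) * v)"
      using sum.reindex_bij_betw[OF bij_betw_nth[OF ws(2) refl refl],
          of "\<lambda>v. of_int (c (ws ! i) v) * v"] by (simp add: n_def ws(1))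
    also have "\<dots> = x * ws ! i"
      by (rule c[symmetric]) (use i ws(1) in \<open>auto simp: n_def\<close>)
    finally show "(M' *\<^sub>v u) $ i = (x \<cdot>\<^sub>v u) $ i"
      using i by (simp add: u_def)
  qed (simp add: M'_def M_def u_def)
  moreover have "u \<noteq> 0\<^sub>v n"
  proof
    assume u: "u = 0\<^sub>v n"
    obtain i where "i < n" "ws ! i = w"
      using w(1) ws(1) by (auto simp: in_set_conv_nth n_def)
    then show False
      using arg_cong[OF u, of "\<lambda>v. v $ i"] w(2) by (simp add: u_def)
  qed
  ultimately have "eigenvalue M' x"
    unfolding eigenvalue_def eigenvector_def using M' by (intro exI[of _ u]) (auto simp: u_def)
  then have "poly (map_poly of_int (char_poly M)) x = 0"
    using eigenvalue_root_char_poly[OF M'] of_int_hom.char_poly_hom[OF M, where ?'a = 'a]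
    by (simp add: M'_def)
  moreover have "lead_coeff (char_poly M) = 1"
    using degree_monic_char_poly[OF M] by simp
  ultimately show ?thesis
    unfolding algebraic_int_altdef_ipoly by blast
qed

text \<open>
  By induction on the set: a span that is stable under the previous elements becomes stable
  under a further \<open>a\<close> too after its generators have been multiplied by the powers of \<open>a\<close> up
  to the degree of a monic integer polynomial with root \<open>a\<close>.
\<close>

lemma ex_common_stable_int_span:
  fixes S :: "'a::field_char_0 set"
  assumes "finite S" and "\<forall>x\<in>S. algebraic_int x"
  shows "\<exists>W. finite W \<and> 1 \<in> W \<and> (\<forall>x\<in>S. \<forall>w\<in>W. x * w \<in> int_module.span W)"
  using assms
proof (induction S rule: finite_induct)
  case empty
  show ?case by (intro exI[of _ "{1}"]) auto
next
  case (insert a S)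
  then obtain W where W: "finite W" "1 \<in> W" "\<And>x w. x \<in> S \<Longrightarrow> w \<in> W \<Longrightarrow> x * w \<in> int_module.span W"
    by auto
  obtain p where p: "poly (map_poly of_int p) a = 0" "lead_coeff p = 1"
    using insert.prems by (auto simp: algebraic_int_altdef_ipoly)
  define n where "n = degree p"
  have "(\<Sum>k\<le>n. of_int (coeff p k) * a ^ k) = 0"
    using p(1) by (simp add: poly_altdef n_def coeff_map_poly degree_map_poly)
  then have an: "a ^ n = (\<Sum>k<n. of_int (- coeff p k) * a ^ k)"
    using p(2) by (simp add: n_def sum_negf eq_neg_iff_add_eq_0 add.commute flip: lessThan_Suc_atMost)
  \<comment> \<open>Including the exponent \<open>n\<close> itself, rather than stopping at \<open>n - 1\<close>, keeps the powers in
    \<open>a * a ^ n = (\<Sum>k<n. - coeff p k * a ^ Suc k)\<close> within range.\<close>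
  define V where "V = (\<lambda>(i, w). a ^ i * w) ` ({..n} \<times> W)"
  have V: "a ^ i * w \<in> V" if "i \<le> n" "w \<in> W" for i w
    using that by (auto simp: V_def)
  have V_span: "a ^ i * y \<in> int_module.span V" if "i \<le> n" "y \<in> int_module.span W" for i y
    by (rule mult_mem_int_span[OF _ that(2)]) (auto intro: int_module.span_base V that(1))
  have "x * v \<in> int_module.span V" if x: "x \<in> insert a S" and v: "v \<in> V" for x v
  proof -
    obtain i w where v: "v = a ^ i * w" "i \<le> n" "w \<in> W"
      using v by (auto simp: V_def)
    show ?thesis
    proof (cases "x = a")
      case False
      then have "a ^ i * (x * w) \<in> int_module.span V"
        using x v W(3) by (intro V_span) auto
      then show ?thesis by (simp add: v(1) mult_ac)
    next
      case x: True
      show ?thesis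
      proof (cases "i < n")
        case True
        then have "a ^ Suc i * w \<in> V"
          using v by (intro V) auto
        moreover have "x * v = a ^ Suc i * w"
          by (simp add: x v(1))
        ultimately show ?thesis
          by (simp only: int_module.span_base)
      next
        case False
        then have "x * v = a * a ^ n * w"
          using v by (simp add: x)
        also have "\<dots> = (\<Sum>k<n. of_int (- coeff p k) * (a ^ Suc k * w))"
          unfolding an by (simp add: sum_distrib_left sum_distrib_right mult_ac)
        also have "\<dots> \<in> int_module.span V"
          using v(3) by (intro int_module.span_sum int_module.span_scale int_module.span_base V) auto
        finally show ?thesis .
      qed
    qed
  qed
  moreover have "finite V" "1 \<in> V"
    using W V[of 0 1] by (auto simp: V_def)
  ultimately show ?case by blast
qed

lemma algebraic_int_plus:
  fixes x y :: "'a::field_char_0"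
  assumes "algebraic_int x" "algebraic_int y"
  shows "algebraic_int (x + y)"
proof -
  obtain W where W: "finite W" "1 \<in> W" "\<And>w. w \<in> W \<Longrightarrow> x * w \<in> int_module.span W"
      "\<And>w. w \<in> W \<Longrightarrow> y * w \<in> int_module.span W"
    using ex_common_stable_int_span[of "{x, y}"] assms by auto
  show ?thesis
    using W by (intro algebraic_int_if_int_span_stable[of W 1])
      (auto simp: distrib_right intro!: int_module.span_add)
qed

lemma algebraic_int_times:
  fixes x y :: "'a::field_char_0"
  assumes "algebraic_int x" "algebraic_int y"
  shows "algebraic_int (x * y)"
proof -
  obtain W where W: "finite W" "1 \<in> W" "\<And>w. w \<in> W \<Longrightarrow> x * w \<in> int_module.span W"
      "\<And>w. w \<in> W \<Longrightarrow> y * w \<in> int_module.span W"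
    using ex_common_stable_int_span[of "{x, y}"] assms by auto
  have "x * (y * w) \<in> int_module.span W" if "w \<in> W" for w
    using W(3) W(4)[OF that] by (rule mult_mem_int_span)
  then show ?thesis
    using W(1,2) by (intro algebraic_int_if_int_span_stable[of W 1]) (simp_all add: mult.assoc)
qed

lemma algebraic_int_sum:
  fixes f :: "'b \<Rightarrow> 'a::field_char_0"
  assumes "\<And>x. x \<in> A \<Longrightarrow> algebraic_int (f x)"
  shows "algebraic_int (sum f A)"
  using assms by (induction A rule: infinite_finite_induct) (auto intro: algebraic_int_plus)

lemma algebraic_int_prod:
  fixes f :: "'b \<Rightarrow> 'a::field_char_0"
  assumes "\<And>x. x \<in> A \<Longrightarrow> algebraic_int (f x)"
  shows "algebraic_int (prod f A)"
  using assms
  by (induction A rule: infinite_finite_induct) (auto intro: algebraic_int_times algebraic_int_1)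

lemma algebraic_int_power:
  fixes x :: "'a::field_char_0"
  shows "algebraic_int x \<Longrightarrow> algebraic_int (x ^ n)"
  by (induction n) (auto intro: algebraic_int_times algebraic_int_1)

lemma algebraic_int_to_ac_iff:
  fixes x :: "'a::field_char_0"
  shows "algebraic_int (to_ac x) \<longleftrightarrow> algebraic_int x"
proof -
  have "poly (map_poly of_int p) (to_ac x) = to_ac (poly (map_poly of_int p) x)" for p :: "int poly"
    by (induction p) (auto simp: map_poly_pCons)
  then show ?thesis by (simp add: algebraic_int_altdef_ipoly)
qed

lemma matrices_over_integers_iff:
  "M \<in> matrices_over d \<O> \<longleftrightarrow>
     M \<in> carrier_mat d d \<and> (\<forall>i<d. \<forall>j<d. algebraic_int (M $$ (i, j)))"
  by (fastforce simp: matrices_over_def ring_of_integers_def)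

lemma matrices_over_integers_mult:
  assumes "M \<in> matrices_over d \<O>" "N \<in> matrices_over d \<O>"
  shows "M * N \<in> matrices_over d \<O>"
  using assms unfolding matrices_over_integers_iff
  by (auto simp: scalar_prod_def intro!: algebraic_int_sum algebraic_int_times)

lemma matrices_over_integers_pow:
  assumes "M \<in> matrices_over d \<O>"
  shows "M ^\<^sub>m k \<in> matrices_over d \<O>"
proof (induction k)
  case 0
  show ?case using assms by (auto simp: matrices_over_integers_iff)
next
  case (Suc k)
  then show ?case using assms by (auto intro: matrices_over_integers_mult)
qed

text \<open>
  If \<open>v\<close> is an eigenvector and \<open>W\<close> spans a group stable under the entries of \<open>A\<close>, then the
  products of entries of \<open>v\<close> with elements of \<open>W\<close> span a group stable under the eigenvalue.
  This avoids passing through a monic polynomial whose coefficients are algebraic integers.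
\<close>

lemma algebraic_int_eigenvalue:
  fixes A :: "'a::field_char_0 mat"
  assumes int: "A \<in> matrices_over d \<O>" and ev: "eigenvalue A x"
  shows "algebraic_int x"
proof -
  have A: "A \<in> carrier_mat d d" using int by (simp add: matrices_over_integers_iff)
  define S where "S = (\<lambda>(i, j). A $$ (i, j)) ` ({..<d} \<times> {..<d})"
  have "finite S" "\<forall>x\<in>S. algebraic_int x"
    using int by (auto simp: S_def matrices_over_integers_iff)
  then obtain W where W: "finite W" "1 \<in> W" "\<And>z w. z \<in> S \<Longrightarrow> w \<in> W \<Longrightarrow> z * w \<in> int_module.span W"
    using ex_common_stable_int_span[of S] by blast
  obtain v where v: "v \<in> carrier_vec d" "v \<noteq> 0\<^sub>v d" "A *\<^sub>v v = x \<cdot>\<^sub>v v"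
    using ev A by (auto simp: eigenvalue_def eigenvector_def)
  define V where "V = (\<lambda>(i, w). v $ i * w) ` ({..<d} \<times> W)"
  have "x * u \<in> int_module.span V" if uV: "u \<in> V" for u
  proof -
    obtain i w where u: "u = v $ i * w" and iw: "i < d" "w \<in> W"
      using uV by (auto simp: V_def)
    have "x * v $ i = (\<Sum>j<d. A $$ (i, j) * v $ j)"
      using arg_cong[OF v(3), of "\<lambda>u. u $ i"] iw v(1) A
      by (simp add: scalar_prod_def atLeast0LessThan)
    then have "x * u = (\<Sum>j<d. v $ j * (A $$ (i, j) * w))"
      by (simp add: u sum_distrib_left mult_ac mult.left_commute[of x])
    also have "\<dots> \<in> int_module.span V"
    proof (rule int_module.span_sum)
      fix j assume j: "j \<in> {..<d}"
      show "v $ j * (A $$ (i, j) * w) \<in> int_module.span V"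
      proof (rule mult_mem_int_span)
        show "A $$ (i, j) * w \<in> int_module.span W"
          using iw j by (intro W(3)) (auto simp: S_def)
        show "v $ j * w \<in> int_module.span V" if "w \<in> W" for w
          using that j by (auto simp: V_def intro!: int_module.span_base)
      qed
    qed
    finally show ?thesis .
  qed
  moreover obtain i where "i < d" "v $ i \<noteq> 0"
    using v by (metis eq_vecI carrier_vecD index_zero_vec)
  moreover from this have "v $ i * 1 \<in> V"
    unfolding V_def using W(2) by (intro image_eqI[of _ _ "(i, 1)"]) auto
  moreover have "finite V"
    using W(1) by (auto simp: V_def)
  ultimately show ?thesis
    by (intro algebraic_int_if_int_span_stable[of V "v $ i * 1"]) auto
qed

section \<open>Coefficients of the adjugate of the characteristic matrix\<close>

definition integral_poly :: "'a::field_char_0 poly \<Rightarrow> bool" where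
  "integral_poly p \<longleftrightarrow> (\<forall>i. algebraic_int (coeff p i))"

lemma integral_poly_mult:
  "integral_poly p \<Longrightarrow> integral_poly q \<Longrightarrow> integral_poly (p * q)"
  by (auto simp: integral_poly_def coeff_mult intro!: algebraic_int_sum algebraic_int_times)

lemma integral_poly_1: "integral_poly 1"
  by (auto simp: integral_poly_def coeff_1)

lemma integral_poly_prod:
  assumes "\<And>x. x \<in> A \<Longrightarrow> integral_poly (f x)"
  shows "integral_poly (prod f A)"
  using assms
  by (induction A rule: infinite_finite_induct)
    (auto intro: integral_poly_mult simp: integral_poly_1)

lemma integral_poly_det:
  assumes M: "M \<in> carrier_mat n n"
    and int: "\<And>i j. i < n \<Longrightarrow> j < n \<Longrightarrow> integral_poly (M $$ (i, j))"
  shows "integral_poly (det M)"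
proof -
  have "integral_poly (signof p * (\<Prod>i = 0..<n. M $$ (i, p i)))" if p: "p permutes {0..<n}" for p
  proof -
    have "integral_poly (\<Prod>i = 0..<n. M $$ (i, p i))"
      using permutes_in_image[OF p] by (intro integral_poly_prod int) auto
    then show ?thesis
      by (cases p rule: sign_cases) (simp_all add: integral_poly_def)
  qed
  then show ?thesis
    unfolding det_def'[OF M] integral_poly_def coeff_sum by (auto intro!: algebraic_int_sum)
qed

lemma integral_poly_adj_mat:
  assumes M: "M \<in> carrier_mat n n"
    and int: "\<And>i j. i < n \<Longrightarrow> j < n \<Longrightarrow> integral_poly (M $$ (i, j))"
    and ij: "i < n" "j < n"
  shows "integral_poly (adj_mat M $$ (i, j))"
proof -
  have "integral_poly (det (mat_delete M j i))"
  proof (rule integral_poly_det[of _ "n - 1"])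
    show "mat_delete M j i \<in> carrier_mat (n - 1) (n - 1)"
      by (rule mat_delete_carrier[OF M])
    fix r s assume "r < n - 1" "s < n - 1"
    then show "integral_poly (mat_delete M j i $$ (r, s))"
      using M by (auto simp: mat_delete_def intro!: int)
  qed
  moreover have "integral_poly ((-1) ^ (j + i) :: 'a poly)"
    by (cases "even (j + i)") (auto simp: integral_poly_def coeff_1)
  ultimately show ?thesis
    using ij M by (auto simp: adj_mat_def cofactor_def intro: integral_poly_mult)
qed

lemma pow_mat_Suc_left:
  fixes A :: "'a::semiring_1 mat"
  assumes "A \<in> carrier_mat d d"
  shows "A ^\<^sub>m Suc k = A * A ^\<^sub>m k"
proof (induction k)
  case (Suc k)
  have "A ^\<^sub>m Suc (Suc k) = A * A ^\<^sub>m k * A"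
    using Suc by simp
  also have "\<dots> = A * A ^\<^sub>m Suc k"
    using assoc_mult_mat[OF assms pow_carrier_mat[OF assms] assms] by simp
  finally show ?case .
qed (use assms in simp)

text \<open>
  Let \<open>C i\<close> be the matrix of \<open>i\<close>-th coefficients of the adjugate of \<open>x - A\<close>. The \<open>i\<close>-th
  coefficients in \<open>adj (x - A) * (x - A) = \<chi>(x) * 1\<close> give \<open>C (i - 1) = C i * A + \<chi>\<^sub>i * 1\<close>, with
  zero in place of \<open>C (i - 1)\<close> for \<open>i = 0\<close>. As long as \<open>\<chi>\<^sub>i\<close> vanishes, multiplying by \<open>A\<close>
  steps the index down, so \<open>C (m - 1)\<close> is annihilated by \<open>A ^ m\<close>, and one more step
  rewrites it as \<open>C m * A + \<chi>\<^sub>m * 1\<close>. The product in the other order gives the same recursion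
  with \<open>A\<close> on the left, whence \<open>C m\<close> commutes with \<open>A\<close>.
\<close>

lemma adjugate_annihilates_power:
  fixes A :: "'a::field_char_0 mat"
  assumes A: "A \<in> carrier_mat d d"
    and low: "\<And>i. i < m \<Longrightarrow> coeff (char_poly A) i = 0"
  obtains C where "C \<in> carrier_mat d d" "C * A = A * C"
    "(C * A + coeff (char_poly A) m \<cdot>\<^sub>m 1\<^sub>m d) * A ^\<^sub>m m = 0\<^sub>m d d"
    "A \<in> matrices_over d \<O> \<Longrightarrow> C \<in> matrices_over d \<O>"
proof -
  define M where "M = char_poly_matrix A"
  define P where "P = adj_mat M"
  define C where "C i = map_mat (\<lambda>p. coeff p i) P" for i
  \<comment> \<open>The shifted sequence: zero at \<open>0\<close>, and \<open>C i\<close> at \<open>Suc i\<close>.\<close>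
  define C' where "C' i = map_mat (\<lambda>p. coeff (pCons 0 p) i) P" for i
  let ?p = "char_poly A"
  have M: "M \<in> carrier_mat d d"
    using A by (simp add: M_def)
  have P: "P \<in> carrier_mat d d" "M * P = ?p \<cdot>\<^sub>m 1\<^sub>m d" "P * M = ?p \<cdot>\<^sub>m 1\<^sub>m d"
    using adj_mat[OF M] by (auto simp: P_def M_def char_poly_def)
  have C: "C i \<in> carrier_mat d d" "C' i \<in> carrier_mat d d" for i
    using P(1) by (auto simp: C_def C'_def)
  have M_entry: "M $$ (r, s) = (if r = s then [:0, 1:] else 0) - [:A $$ (r, s):]" if "r < d" "s < d" for r s
    using that A by (auto simp: M_def char_poly_matrix_def)
  have left: "C' i = A * C i + coeff ?p i \<cdot>\<^sub>m 1\<^sub>m d" for i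
  proof (rule eq_matI)
    fix r s assume "r < dim_row (A * C i + coeff ?p i \<cdot>\<^sub>m 1\<^sub>m d)" "s < dim_col (A * C i + coeff ?p i \<cdot>\<^sub>m 1\<^sub>m d)"
    then have rs: "r < d" "s < d" by auto
    have "(M * P) $$ (r, s) = (\<Sum>k<d. M $$ (r, k) * P $$ (k, s))"
      using rs M P(1) by (simp add: scalar_prod_def atLeast0LessThan)
    also have "\<dots> = (\<Sum>k<d. (if k = r then [:0, 1:] * P $$ (k, s) else 0) - [:A $$ (r, k):] * P $$ (k, s))"
      using rs by (intro sum.cong) (auto simp: M_entry left_diff_distrib)
    also have "\<dots> = pCons 0 (P $$ (r, s)) - (\<Sum>k<d. smult (A $$ (r, k)) (P $$ (k, s)))"
      using rs by (simp add: sum_subtractf sum.delta)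
    finally have "coeff ((M * P) $$ (r, s)) i = C' i $$ (r, s) - (A * C i) $$ (r, s)"
      using rs A P(1) by (simp add: C_def C'_def scalar_prod_def atLeast0LessThan coeff_sum)
    then show "C' i $$ (r, s) = (A * C i + coeff ?p i \<cdot>\<^sub>m 1\<^sub>m d) $$ (r, s)"
      using rs A C[of i] P(2) by (auto split: if_splits)
  qed (use A C[of i] in auto)
  have right: "C' i = C i * A + coeff ?p i \<cdot>\<^sub>m 1\<^sub>m d" for i
  proof (rule eq_matI)
    fix r s assume "r < dim_row (C i * A + coeff ?p i \<cdot>\<^sub>m 1\<^sub>m d)" "s < dim_col (C i * A + coeff ?p i \<cdot>\<^sub>m 1\<^sub>m d)"
    then have rs: "r < d" "s < d" by auto
    have "(P * M) $$ (r, s) = (\<Sum>k<d. P $$ (r, k) * M $$ (k, s))"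
      using rs M P(1) by (simp add: scalar_prod_def atLeast0LessThan)
    also have "\<dots> = (\<Sum>k<d. (if k = s then [:0, 1:] * P $$ (r, k) else 0) - [:A $$ (k, s):] * P $$ (r, k))"
      using rs by (intro sum.cong) (auto simp: M_entry algebra_simps)
    also have "\<dots> = pCons 0 (P $$ (r, s)) - (\<Sum>k<d. smult (A $$ (k, s)) (P $$ (r, k)))"
      using rs by (simp add: sum_subtractf sum.delta)
    finally have "coeff ((P * M) $$ (r, s)) i = C' i $$ (r, s) - (C i * A) $$ (r, s)"
      using rs A P(1) by (simp add: C_def C'_def scalar_prod_def atLeast0LessThan coeff_sum mult.commute)
    then show "C' i $$ (r, s) = (C i * A + coeff ?p i \<cdot>\<^sub>m 1\<^sub>m d) $$ (r, s)"
      using rs A C[of i] P(3) by (auto split: if_splits)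
  qed (use A C[of i] in auto)
  have comm: "C i * A = A * C i" for i
  proof (rule eq_matI)
    fix r s assume "r < dim_row (A * C i)" "s < dim_col (A * C i)"
    then show "(C i * A) $$ (r, s) = (A * C i) $$ (r, s)"
      using arg_cong[OF trans[OF left[of i, symmetric] right[of i]], of "\<lambda>N. N $$ (r, s)"] A C[of i]
      by auto
  qed (use A C[of i] in auto)
  have annihilates: "C' i * A ^\<^sub>m i = 0\<^sub>m d d" if "i \<le> m" for i
    using that
  proof (induction i)
    case 0
    show ?case using P(1) A by (auto simp: C'_def intro!: eq_matI)
  next
    case (Suc i)
    have "C' (Suc i) = C i"
      by (auto simp: C_def C'_def)
    then have "C' (Suc i) * A ^\<^sub>m Suc i = C i * (A * A ^\<^sub>m i)"
      unfolding pow_mat_Suc_left[OF A] by simp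
    also have "\<dots> = (C i * A) * A ^\<^sub>m i"
      using assoc_mult_mat[OF C(1)[of i] A, of "A ^\<^sub>m i" d] A by simp
    also have "C i * A = C' i"
      using right[of i] low[of i] Suc.prems A C[of i] by (auto intro!: eq_matI)
    also have "C' i * A ^\<^sub>m i = 0\<^sub>m d d"
      using Suc by simp
    finally show ?case .
  qed
  have "C m \<in> matrices_over d \<O>" if int: "A \<in> matrices_over d \<O>"
  proof -
    have "integral_poly (M $$ (r, s))" if rs: "r < d" "s < d" for r s
    proof -
      have "algebraic_int (A $$ (r, s))"
        using int rs by (simp add: matrices_over_integers_iff)
      then show ?thesis
        unfolding M_entry[OF rs]
        by (auto simp: integral_poly_def coeff_pCons split: nat.splits
            intro!: algebraic_int_plus[of 1, simplified])
    qed
    then have "integral_poly (P $$ (i, j))" if "i < d" "j < d" for i j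
      unfolding P_def using that by (intro integral_poly_adj_mat[OF M])
    then show ?thesis
      using P(1) by (simp add: matrices_over_integers_iff C_def integral_poly_def)
  qed
  then show ?thesis
    using that[of "C m"] C(1)[of m] comm[of m] annihilates[of m] right[of m] by simp
qed

section \<open>Eigenvalues of powers and products of roots\<close>

lemma sum_coeff_linear_factor_mult:
  fixes p :: "'a::comm_ring_1 poly" and f :: "nat \<Rightarrow> 'a"
  assumes "degree p \<le> n"
  shows "(\<Sum>j\<le>Suc n. coeff ([:-a, 1:] * p) j * f j) = (\<Sum>j\<le>n. coeff p j * (f (Suc j) - a * f j))"
proof -
  have "(\<Sum>j\<le>Suc n. coeff ([:-a, 1:] * p) j * f j)
      = (\<Sum>j\<le>Suc n. coeff (pCons 0 p) j * f j) - (\<Sum>j\<le>Suc n. a * (coeff p j * f j))"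
    unfolding sum_subtractf[symmetric] by (intro sum.cong) (auto simp: algebra_simps)
  also have "(\<Sum>j\<le>Suc n. coeff (pCons 0 p) j * f j) = (\<Sum>j\<le>n. coeff p j * f (Suc j))"
    by (simp add: sum.atMost_Suc_shift del: sum.atMost_Suc)
  also have "(\<Sum>j\<le>Suc n. a * (coeff p j * f j)) = (\<Sum>j\<le>n. a * (coeff p j * f j))"
    using assms by (simp add: coeff_eq_0)
  finally show ?thesis
    by (simp add: algebra_simps flip: sum_subtractf)
qed

lemma degree_prod_list_linear_factors: "degree (\<Prod>a\<leftarrow>as. [:-a, 1 :: 'a::idom:]) = length as"
proof (induction as)
  case (Cons a as)
  have "(\<Prod>a\<leftarrow>as. [:-a, 1:]) \<noteq> 0"
    by (auto simp: prod_list_zero_iff)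
  with Cons show ?case by (simp add: degree_mult_eq del: mult_pCons_left)
qed simp

text \<open>
  Here \<open>w i\<close> is \<open>A ^ i\<close> applied to \<open>w 0\<close>, and the last hypothesis says that the product of the
  factors \<open>A - a\<close> kills \<open>w 0\<close>. Applying the factors one after the other to \<open>w 0\<close>, some factor
  is the first to produce zero, and the vector it is applied to is an eigenvector. Working with
  the sequence \<open>w\<close> reduces the evaluation of polynomials at a matrix to sums of scalars.
\<close>

lemma eigenvalue_of_annihilating_linear_factors:
  fixes A :: "'a::field mat"
  assumes A: "A \<in> carrier_mat d d"
    and w: "\<And>i. w i \<in> carrier_vec d" "\<And>i. w (Suc i) = A *\<^sub>v w i" "w 0 \<noteq> 0\<^sub>v d"
    and zero: "\<And>k. k < d \<Longrightarrow> (\<Sum>j\<le>length as. coeff (\<Prod>a\<leftarrow>as. [:-a, 1:]) j * w j $ k) = 0"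
  shows "\<exists>a\<in>set as. eigenvalue A a"
  using w zero
proof (induction as arbitrary: w)
  case Nil
  have "w 0 = 0\<^sub>v d"
    using Nil(1)[of 0] Nil(4) by (intro eq_vecI) auto
  then show ?case using Nil(3) by simp
next
  case (Cons a as)
  \<comment> \<open>The same sequence after the factor \<open>A - a\<close> has been applied.\<close>
  define u where "u i = w (Suc i) - a \<cdot>\<^sub>v w i" for i
  have u: "u i \<in> carrier_vec d" for i
    using Cons.prems(1) by (simp add: u_def)
  show ?case
  proof (cases "u 0 = 0\<^sub>v d")
    case True
    have "A *\<^sub>v w 0 = a \<cdot>\<^sub>v w 0"
    proof (rule eq_vecI)
      fix i assume "i < dim_vec (a \<cdot>\<^sub>v w 0)"
      then show "(A *\<^sub>v w 0) $ i = (a \<cdot>\<^sub>v w 0) $ i"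
        using arg_cong[OF True, of "\<lambda>v. v $ i"] Cons.prems(1)[of 0] A
        by (simp add: u_def Cons.prems(2))
    qed (use A Cons.prems(1)[of 0] in auto)
    then have "eigenvalue A a"
      using Cons.prems(1,3) A unfolding eigenvalue_def eigenvector_def by (intro exI[of _ "w 0"]) auto
    then show ?thesis by simp
  next
    case False
    have "u (Suc i) = A *\<^sub>v u i" for i
      using A Cons.prems(1)[of i] Cons.prems(1)[of "Suc i"]
      by (simp add: u_def Cons.prems(2) mult_minus_distrib_mat_vec mult_mat_vec)
    moreover have "(\<Sum>j\<le>length as. coeff (\<Prod>a\<leftarrow>as. [:-a, 1:]) j * u j $ k) = 0" if k: "k < d" for k
    proof -
      have dim: "dim_vec (w i) = d" for i
        using Cons.prems(1)[of i] by simp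
      have "(\<Sum>j\<le>length as. coeff (\<Prod>a\<leftarrow>as. [:-a, 1:]) j * (w (Suc j) $ k - a * w j $ k)) = 0"
        using Cons.prems(4)[OF k]
          sum_coeff_linear_factor_mult[of "\<Prod>a\<leftarrow>as. [:-a, 1:]" "length as" a "\<lambda>j. w j $ k"]
        by (simp add: degree_prod_list_linear_factors del: sum.atMost_Suc)
      then show ?thesis
        using k by (simp add: u_def dim)
    qed
    ultimately show ?thesis
      using Cons.IH[of u] u False by auto
  qed
qed

text \<open>
  An eigenvector of \<open>A ^ n\<close> for \<open>x\<close> is killed by the polynomial \<open>z ^ n - x\<close> evaluated at \<open>A\<close>,
  which splits into linear factors; so one of the roots of that polynomial is an eigenvalue of
  \<open>A\<close>.
\<close>

lemma eigenvalue_pow_imp_eigenvalue: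
  fixes A :: "'a::alg_closed_field mat"
  assumes A: "A \<in> carrier_mat d d" and n: "n > 0" and ev: "eigenvalue (A ^\<^sub>m n) x"
  shows "\<exists>y. eigenvalue A y \<and> y ^ n = x"
proof -
  obtain v where v: "v \<in> carrier_vec d" "v \<noteq> 0\<^sub>v d" "A ^\<^sub>m n *\<^sub>v v = x \<cdot>\<^sub>v v"
    using ev A by (auto simp: eigenvalue_def eigenvector_def)
  define p where "p = monom 1 n - [:x:]"
  have coeff_p: "coeff p j = (if j = n then 1 else 0) - (if j = 0 then x else 0)" for j
    by (auto simp: p_def coeff_pCons split: nat.splits)
  have deg: "degree p = n"
    using n coeff_p by (intro antisym degree_le le_degree) auto
  have "p \<noteq> 0" using deg n by auto
  then obtain M where M: "size M = n" "p = (\<Prod>a\<in>#M. [:-a, 1:])"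
    using alg_closed_imp_factorization[of p] deg n by (auto simp: coeff_p)
  obtain as where as: "mset as = M" using ex_mset by blast
  have p: "p = (\<Prod>a\<leftarrow>as. [:-a, 1:])" and len: "length as = n"
    using M by (auto simp flip: as prod_mset_prod_list size_mset)
  have "\<exists>a\<in>set as. eigenvalue A a"
  proof (rule eigenvalue_of_annihilating_linear_factors[OF A])
    show "A ^\<^sub>m i *\<^sub>v v \<in> carrier_vec d" for i
      by (rule mult_mat_vec_carrier[OF pow_carrier_mat[OF A] v(1)])
    show "A ^\<^sub>m 0 *\<^sub>v v \<noteq> 0\<^sub>v d"
      using A v by auto
    show "A ^\<^sub>m Suc i *\<^sub>v v = A *\<^sub>v (A ^\<^sub>m i *\<^sub>v v)" for i
      unfolding pow_mat_Suc_left[OF A]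
      by (rule assoc_mult_mat_vec[OF A pow_carrier_mat[OF A] v(1)])
    fix k assume k: "k < d"
    have "(\<Sum>j\<le>n. coeff p j * (A ^\<^sub>m j *\<^sub>v v) $ k)
       = (\<Sum>j\<le>n. (if j = n then (A ^\<^sub>m j *\<^sub>v v) $ k else 0) - (if j = 0 then x * (A ^\<^sub>m j *\<^sub>v v) $ k else 0))"
      unfolding coeff_p by (intro sum.cong) (auto simp: left_diff_distrib)
    also have "\<dots> = (A ^\<^sub>m n *\<^sub>v v) $ k - x * v $ k"
      using A v(1) by (simp add: sum_subtractf)
    also have "\<dots> = 0"
      using k v(1) by (simp add: v(3))
    finally show "(\<Sum>j\<le>length as. coeff (\<Prod>a\<leftarrow>as. [:-a, 1:]) j * (A ^\<^sub>m j *\<^sub>v v) $ k) = 0"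
      by (simp add: p len)
  qed
  then obtain a where a: "a \<in> set as" "eigenvalue A a" by auto
  have "poly p a = 0"
    using a(1) unfolding p poly_prod_list by (force simp: prod_list_zero_iff)
  then have "a ^ n = x" by (simp add: p_def poly_monom)
  with a(2) show ?thesis by auto
qed

lemma alg_closed_monic_eq_prod_roots:
  fixes p :: "'a::alg_closed_field poly"
  assumes "lead_coeff p = 1"
  shows "p = (\<Prod>a | poly p a = 0. [:-a, 1:] ^ order a p)"
proof -
  have "p \<noteq> 0" using assms by auto
  then obtain M where M: "p = (\<Prod>a\<in>#M. [:-a, 1:])"
    using alg_closed_imp_factorization[of p] assms by auto
  have "proots p = M"
    unfolding M
  proof (induction M)
    case (add a M)
    have "(\<Prod>a\<in>#M. [:-a, 1:]) \<noteq> 0"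
      by (auto simp: prod_mset_zero_iff)
    with add show ?case by (simp add: proots_mult del: mult_pCons_left)
  qed simp
  then have "p = (\<Prod>a\<in>#proots p. [:-a, 1:])"
    using M by simp
  also have "\<dots> = (\<Prod>a | poly p a = 0. [:-a, 1:] ^ order a p)"
    using \<open>p \<noteq> 0\<close> by (simp add: image_prod_mset_multiplicity)
  finally show ?thesis .
qed

text \<open>
  Separating the root \<open>0\<close> writes \<open>p\<close> as a power of the variable times a product of the
  remaining linear factors, whose constant coefficient is the product on the right.
\<close>

lemma alg_closed_lowest_coeff:
  fixes p :: "'a::alg_closed_field poly"
  assumes monic: "lead_coeff p = 1"
  shows "coeff p (order 0 p) = (\<Prod>a | poly p a = 0 \<and> a \<noteq> 0. (-a) ^ order a p)"
    and "i < order 0 p \<Longrightarrow> coeff p i = 0"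
proof -
  define q where "q = (\<Prod>a | poly p a = 0 \<and> a \<noteq> 0. [:-a, 1:] ^ order a p)"
  have p0: "p \<noteq> 0" using monic by auto
  then have fin: "finite {a. poly p a = 0}" by (rule poly_roots_finite)
  have "p = (\<Prod>a \<in> insert 0 {a. poly p a = 0 \<and> a \<noteq> 0}. [:-a, 1:] ^ order a p)"
  proof (cases "poly p 0 = 0")
    case True
    then have "insert 0 {a. poly p a = 0 \<and> a \<noteq> 0} = {a. poly p a = 0}" by auto
    then show ?thesis using alg_closed_monic_eq_prod_roots[OF monic] by simp
  next
    case False
    then have "{a. poly p a = 0} = {a. poly p a = 0 \<and> a \<noteq> 0}" by auto
    then show ?thesis
      using alg_closed_monic_eq_prod_roots[OF monic] False fin by (simp add: order_0I)
  qed
  also have "\<dots> = [:0, 1:] ^ order 0 p * q"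
    using fin by (subst prod.insert) (auto simp: q_def)
  finally have p: "p = monom 1 (order 0 p) * q"
    by (simp add: monom_altdef)
  have "coeff p i = (if i < order 0 p then 0 else coeff q (i - order 0 p))" for i
    by (subst p) (simp add: coeff_monom_mult)
  moreover have "coeff q 0 = (\<Prod>a | poly p a = 0 \<and> a \<noteq> 0. (-a) ^ order a p)"
    by (simp add: q_def poly_prod flip: poly_0_coeff_0)
  ultimately show "coeff p (order 0 p) = (\<Prod>a | poly p a = 0 \<and> a \<noteq> 0. (-a) ^ order a p)"
    and "i < order 0 p \<Longrightarrow> coeff p i = 0"
    by simp_all
qed

section \<open>Drazin inverses in a monoid\<close>

text \<open>
  The existence, the uniqueness and the projection of the Drazin inverse involve multiplication
  only, so they are treated in an arbitrary monoid and applied to the monoid of square matrices.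
\<close>

context monoid
begin

lemma nat_pow_commutes:
  assumes "x \<in> carrier G" "y \<in> carrier G" "x \<otimes> y = y \<otimes> x"
  shows "x [^] (i::nat) \<otimes> y [^] (j::nat) = y [^] j \<otimes> x [^] i"
proof -
  have "x [^] i \<otimes> y = y \<otimes> x [^] i"
    using assms by (intro group_commutes_pow)
  then show ?thesis
    using assms by (intro group_commutes_pow[symmetric]) auto
qed

lemma idempotent_nat_pow_mult:
  assumes "e \<in> carrier G" "e \<otimes> e = e"
  shows "e [^] (i::nat) \<otimes> e = e"
  using assms by (induction i) (simp_all add: m_assoc)

lemma pow_absorbs_left_quotient:
  assumes b: "b \<in> carrier G" and v: "v \<in> carrier G" and bv: "b [^] (m::nat) = v \<otimes> b [^] Suc m"
  shows "v [^] (j::nat) \<otimes> b [^] (j + m) = b [^] m"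
proof (induction j)
  case 0
  show ?case using b by simp
next
  case (Suc j)
  have "v [^] Suc j \<otimes> b [^] (Suc j + m) = v [^] j \<otimes> v \<otimes> (b [^] Suc m \<otimes> b [^] j)"
    unfolding nat_pow_mult[OF b] by (simp add: add_ac)
  also have "\<dots> = v [^] j \<otimes> ((v \<otimes> b [^] Suc m) \<otimes> b [^] j)"
    using b v by (simp only: m_assoc m_closed nat_pow_closed)
  also have "\<dots> = v [^] j \<otimes> b [^] (j + m)"
    unfolding bv[symmetric] nat_pow_mult[OF b] by (simp add: add.commute)
  finally show ?case using Suc by simp
qed

lemma pow_absorbs_right_quotient:
  assumes b: "b \<in> carrier G" and v: "v \<in> carrier G" and bv: "b [^] (m::nat) = b [^] Suc m \<otimes> v"
  shows "b [^] (j + m) \<otimes> v [^] (j::nat) = b [^] m"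
proof (induction j)
  case 0
  show ?case using b by simp
next
  case (Suc j)
  have "b [^] (Suc j + m) \<otimes> v [^] Suc j = (b [^] j \<otimes> b [^] Suc m) \<otimes> (v \<otimes> v [^] j)"
    unfolding nat_pow_mult[OF b] nat_pow_Suc2[OF v, symmetric] by (simp add: add_ac)
  also have "\<dots> = b [^] j \<otimes> (b [^] Suc m \<otimes> v) \<otimes> v [^] j"
    using b v by (simp only: m_assoc m_closed nat_pow_closed)
  also have "\<dots> = b [^] (j + m) \<otimes> v [^] j"
    unfolding bv[symmetric] nat_pow_mult[OF b] ..
  finally show ?case using Suc by simp
qed

text \<open>
  The left quotient \<open>v\<close> provides the inverse, namely \<open>v ^ Suc m * a ^ m\<close>, which satisfies the
  absorption law at the exponent \<open>m\<close>. The right quotient \<open>x\<close> transfers that law from \<open>m\<close> to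
  the exponent \<open>k\<close>, which may be smaller: \<open>a ^ k = a ^ (m + k) * x ^ m\<close>.
\<close>

lemma drazin_exists:
  assumes a: "a \<in> carrier G" and v: "v \<in> carrier G" "v \<otimes> a = a \<otimes> v"
    and av: "a [^] (m::nat) = v \<otimes> a [^] Suc m"
    and x: "x \<in> carrier G" "a [^] (k::nat) = a [^] Suc k \<otimes> x"
  shows "\<exists>d\<in>carrier G. a \<otimes> d = d \<otimes> a \<and> d \<otimes> a \<otimes> d = d \<and> a \<otimes> d \<otimes> a [^] k = a [^] k"
proof -
  define d where "d = v [^] Suc m \<otimes> a [^] m"
  have d: "d \<in> carrier G"
    using a v by (simp add: d_def)
  have va: "v [^] i \<otimes> a [^] j = a [^] j \<otimes> v [^] i" for i j :: nat
    using a v by (intro nat_pow_commutes)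
  have comm: "a \<otimes> d = d \<otimes> a"
  proof -
    define V P where "V = v [^] Suc m" and "P = a [^] m"
    have carr: "V \<in> carrier G" "P \<in> carrier G"
      using a v by (auto simp: V_def P_def)
    have "a \<otimes> (V \<otimes> P) = (a \<otimes> V) \<otimes> P"
      using a carr by (simp add: m_assoc)
    also have "a \<otimes> V = V \<otimes> a"
      unfolding V_def using a v by (intro group_commutes_pow[symmetric])
    also have "V \<otimes> a \<otimes> P = V \<otimes> (a \<otimes> P)"
      using a carr by (simp add: m_assoc)
    also have "a \<otimes> P = P \<otimes> a"
      unfolding P_def using a by (intro group_commutes_pow[symmetric]) auto
    also have "V \<otimes> (P \<otimes> a) = (V \<otimes> P) \<otimes> a"
      using a carr by (simp add: m_assoc)
    finally show ?thesis by (simp only: d_def V_def P_def)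
  qed
  have absorb: "v [^] Suc m \<otimes> a [^] (Suc m + m) = a [^] m"
    using a v(1) av by (rule pow_absorbs_left_quotient)
  have "d \<otimes> a [^] Suc m = a [^] m"
  proof -
    have "d \<otimes> a [^] Suc m = v [^] Suc m \<otimes> (a [^] m \<otimes> a [^] Suc m)"
      unfolding d_def using a v(1) by (simp only: m_assoc nat_pow_closed)
    also have "\<dots> = v [^] Suc m \<otimes> a [^] (Suc m + m)"
      unfolding nat_pow_mult[OF a] by (simp add: add.commute)
    finally show ?thesis using absorb by simp
  qed
  then have dam: "a \<otimes> d \<otimes> a [^] m = a [^] m"
    using a d by (simp add: comm m_assoc flip: nat_pow_Suc2 del: nat_pow_Suc)
  have "d \<otimes> a \<otimes> d = (a \<otimes> d) \<otimes> (a [^] m \<otimes> v [^] Suc m)"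
    unfolding comm using va[of "Suc m" m] by (simp add: d_def del: nat_pow_Suc)
  also have "\<dots> = (a \<otimes> d \<otimes> a [^] m) \<otimes> v [^] Suc m"
    using a d v by (simp add: m_assoc del: nat_pow_Suc)
  also have "\<dots> = d"
    unfolding dam using va[of "Suc m" m] by (simp add: d_def del: nat_pow_Suc)
  finally have dad: "d \<otimes> a \<otimes> d = d" .
  have "a [^] k = a [^] (m + k) \<otimes> x [^] m"
    using pow_absorbs_right_quotient[OF a x, of m] by simp
  also have "a [^] (m + k) = a [^] m \<otimes> a [^] k"
    using a by (simp add: nat_pow_mult)
  finally have ak: "a [^] k = a [^] m \<otimes> a [^] k \<otimes> x [^] m" .
  have "a \<otimes> d \<otimes> a [^] k = (a \<otimes> d \<otimes> a [^] m) \<otimes> (a [^] k \<otimes> x [^] m)"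
    by (subst ak) (use a d x in \<open>simp add: m_assoc\<close>)
  also have "\<dots> = a [^] k"
    unfolding dam by (subst (2) ak) (use a x in \<open>simp add: m_assoc\<close>)
  finally show ?thesis
    using comm dad d by blast
qed

lemma drazin_projection_pow:
  assumes a: "a \<in> carrier G"
    and d: "d \<in> carrier G" "a \<otimes> d = d \<otimes> a" "d \<otimes> a \<otimes> d = d"
  shows "(a \<otimes> d) [^] (i::nat) \<otimes> (a \<otimes> d) = a \<otimes> d"
    and "a [^] i \<otimes> d [^] i \<otimes> (a \<otimes> d) = a \<otimes> d"
    and "(a \<otimes> d) \<otimes> (d [^] i \<otimes> a [^] i) = a \<otimes> d"
proof -
  have "(a \<otimes> d) \<otimes> (a \<otimes> d) = a \<otimes> (d \<otimes> a \<otimes> d)"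
    using a d(1) by (simp only: m_assoc m_closed)
  then have "(a \<otimes> d) \<otimes> (a \<otimes> d) = a \<otimes> d"
    unfolding d(3) .
  then show 1: "(a \<otimes> d) [^] i \<otimes> (a \<otimes> d) = a \<otimes> d"
    using a d(1) by (intro idempotent_nat_pow_mult) auto
  then show "a [^] i \<otimes> d [^] i \<otimes> (a \<otimes> d) = a \<otimes> d"
    unfolding pow_mult_distrib[OF d(2) a d(1)] .
  have "(a \<otimes> d) \<otimes> (a \<otimes> d) [^] i = a \<otimes> d"
    using 1 nat_pow_comm[of "a \<otimes> d" 1 i] a d(1) by simp
  then show "(a \<otimes> d) \<otimes> (d [^] i \<otimes> a [^] i) = a \<otimes> d"
    using nat_pow_commutes[OF a d(1,2), of i i] pow_mult_distrib[OF d(2) a d(1), of i] by simp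
qed

lemma drazin_projection_comm:
  assumes "a \<in> carrier G" "d \<in> carrier G" "a \<otimes> d = d \<otimes> a"
  shows "a [^] (i::nat) \<otimes> (a \<otimes> d) = (a \<otimes> d) \<otimes> a [^] i"
proof (rule group_commutes_pow)
  have "a \<otimes> (a \<otimes> d) = a \<otimes> (d \<otimes> a)"
    unfolding assms(3) ..
  then show "a \<otimes> (a \<otimes> d) = (a \<otimes> d) \<otimes> a"
    using assms(1,2) by (simp add: m_assoc)
qed (use assms in auto)

text \<open>
  For two inverses the idempotents \<open>e = a * x\<close> and \<open>f = a * y\<close> absorb each other on both sides,
  because \<open>e = a ^ k * x ^ k * e\<close> and \<open>f\<close> fixes \<open>a ^ k\<close>. Hence \<open>e = f\<close>, and each inverse is
  recovered from its idempotent.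
\<close>

lemma drazin_unique:
  assumes a: "a \<in> carrier G"
    and x: "x \<in> carrier G" "a \<otimes> x = x \<otimes> a" "x \<otimes> a \<otimes> x = x" "a \<otimes> x \<otimes> a [^] (k::nat) = a [^] k"
    and y: "y \<in> carrier G" "a \<otimes> y = y \<otimes> a" "y \<otimes> a \<otimes> y = y" "a \<otimes> y \<otimes> a [^] k = a [^] k"
  shows "x = y"
proof -
  have absorb: "(a \<otimes> w) \<otimes> (a \<otimes> z) = a \<otimes> z" "(a \<otimes> z) \<otimes> (a \<otimes> w) = a \<otimes> z"
    if z: "z \<in> carrier G" "a \<otimes> z = z \<otimes> a" "z \<otimes> a \<otimes> z = z"
      and w: "w \<in> carrier G" "a \<otimes> w = w \<otimes> a" "a \<otimes> w \<otimes> a [^] k = a [^] k" for z w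
  proof -
    define e f where "e = a \<otimes> z" and "f = a \<otimes> w"
    have carr: "e \<in> carrier G" "f \<in> carrier G" "a [^] k \<in> carrier G" "z [^] k \<in> carrier G"
      using a z(1) w(1) by (auto simp: e_def f_def)
    have fa: "f \<otimes> a [^] k = a [^] k" "a [^] k \<otimes> f = a [^] k"
      using w(3) drazin_projection_comm[OF a w(1,2), of k] by (auto simp: f_def)
    have e1: "a [^] k \<otimes> z [^] k \<otimes> e = e" and e2: "e \<otimes> (z [^] k \<otimes> a [^] k) = e"
      using drazin_projection_pow(2,3)[OF a z] by (auto simp: e_def)
    have "f \<otimes> e = f \<otimes> (a [^] k \<otimes> z [^] k \<otimes> e)"
      unfolding e1 ..
    also have "\<dots> = (f \<otimes> a [^] k) \<otimes> z [^] k \<otimes> e"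
      using carr by (simp only: m_assoc m_closed)
    also have "\<dots> = e"
      unfolding fa e1 ..
    finally show "(a \<otimes> w) \<otimes> (a \<otimes> z) = a \<otimes> z"
      unfolding e_def f_def .
    have "e \<otimes> f = e \<otimes> (z [^] k \<otimes> a [^] k) \<otimes> f"
      unfolding e2 ..
    also have "\<dots> = e \<otimes> (z [^] k \<otimes> (a [^] k \<otimes> f))"
      using carr by (simp only: m_assoc m_closed)
    also have "\<dots> = e"
      unfolding fa e2 ..
    finally show "(a \<otimes> z) \<otimes> (a \<otimes> w) = a \<otimes> z"
      unfolding e_def f_def .
  qed
  have e: "a \<otimes> x = a \<otimes> y"
    using absorb(1)[OF x(1-3) y(1,2,4)] absorb(2)[OF y(1-3) x(1,2,4)] by simp
  have "x = x \<otimes> (a \<otimes> x)"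
    using x(3) a x(1) by (simp only: m_assoc)
  also have "\<dots> = x \<otimes> a \<otimes> y"
    unfolding e using a x(1) y(1) by (simp only: m_assoc)
  also have "\<dots> = y \<otimes> a \<otimes> y"
    using e by (simp only: x(2) y(2))
  finally show ?thesis using y(3) by simp
qed

text \<open>
  With \<open>b = a ^ n\<close>, the idempotent \<open>e = a * d\<close> is a right multiple of every power of \<open>b\<close>, in
  particular of \<open>b ^ m = v ^ k * b ^ k * b ^ m\<close>; so \<open>e = v ^ k * b ^ k * e\<close>. As \<open>b ^ k\<close> is a
  multiple of \<open>a ^ k\<close>, it absorbs \<open>e\<close>. It is this formula that turns the integrality of \<open>v\<close> and
  \<open>b\<close> into that of \<open>e\<close>.
\<close>

lemma drazin_projection_eq:
  assumes a: "a \<in> carrier G"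
    and d: "d \<in> carrier G" "a \<otimes> d = d \<otimes> a" "d \<otimes> a \<otimes> d = d" "a \<otimes> d \<otimes> a [^] (k::nat) = a [^] k"
    and n: "n > 0"
    and v: "v \<in> carrier G" "(a [^] n) [^] (m::nat) = v \<otimes> (a [^] (n::nat)) [^] Suc m"
  shows "a \<otimes> d = v [^] k \<otimes> (a [^] n) [^] k"
proof -
  define b where "b = a [^] n"
  define e where "e = a \<otimes> d"
  define r where "r = d [^] (n * m) \<otimes> e"
  have carr: "b \<in> carrier G" "e \<in> carrier G" "r \<in> carrier G" "b [^] j \<in> carrier G" "v [^] j \<in> carrier G"
    for j :: nat
    using a d(1) v(1) by (auto simp: b_def e_def r_def)
  have er: "b [^] m \<otimes> r = e"
    using drazin_projection_pow(2)[OF a d(1-3), of "n * m"] a d(1)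
    by (simp add: b_def r_def e_def nat_pow_pow m_assoc)
  have "k \<le> n * k" using n by simp
  then have bk: "b [^] k = a [^] k \<otimes> a [^] (n * k - k)"
    using a by (simp add: b_def nat_pow_pow nat_pow_mult)
  have "e \<otimes> b [^] k = (e \<otimes> a [^] k) \<otimes> a [^] (n * k - k)"
    unfolding bk using a carr by (simp add: m_assoc)
  also have "\<dots> = b [^] k"
    unfolding e_def d(4) bk ..
  finally have bke: "b [^] k \<otimes> e = b [^] k"
    using drazin_projection_comm[OF a d(1,2), of "n * k"] a by (simp add: b_def e_def nat_pow_pow)
  have "v [^] k \<otimes> b [^] (k + m) = b [^] m"
    using carr v by (intro pow_absorbs_left_quotient) (auto simp: b_def)
  then have bm: "b [^] m = v [^] k \<otimes> (b [^] k \<otimes> b [^] m)"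
    using carr(1) by (simp add: nat_pow_mult)
  have "e = v [^] k \<otimes> (b [^] k \<otimes> b [^] m) \<otimes> r"
    unfolding bm[symmetric] er ..
  also have "\<dots> = v [^] k \<otimes> (b [^] k \<otimes> (b [^] m \<otimes> r))"
    using carr by (simp only: m_assoc m_closed)
  also have "\<dots> = v [^] k \<otimes> b [^] k"
    unfolding er bke ..
  finally show ?thesis by (simp add: e_def b_def)
qed

end

section \<open>Ranks of consecutive powers\<close>

context vec_space
begin

lemma col_space_mult_subset:
  assumes "A \<in> carrier_mat n nc" "B \<in> carrier_mat nc m"
  shows "col_space (A * B) \<subseteq> col_space A"
proof
  fix y assume "y \<in> col_space (A * B)"
  then obtain x where x: "x \<in> carrier_vec m" "A * B *\<^sub>v x = y" "y \<in> carrier_vec n"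
    using assms by (auto simp: col_space_eq[OF mult_carrier_mat[OF assms]])
  then have "A *\<^sub>v (B *\<^sub>v x) = y"
    using assoc_mult_mat_vec[OF assms x(1)] by simp
  then show "y \<in> col_space A"
    using assms x by (auto simp: col_space_eq[OF assms(1)])
qed

lemma span_eq_if_subset_dim_eq:
  assumes A: "A \<subseteq> carrier_vec n" "finite A" and B: "B \<subseteq> carrier_vec n" "finite B"
    and sub: "span B \<subseteq> span A"
    and dim: "vectorspace.dim class_ring (span_vs A) = vectorspace.dim class_ring (span_vs B)"
  shows "span B = span A"
proof -
  have subm: "submodule class_ring (span A) V" "submodule class_ring (span B) V"
    using A B by (auto intro!: span_is_submodule)
  interpret VA: vectorspace class_ring "span_vs A"
    using span_is_subspace[of A] A subspace_is_vs by simp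
  interpret VB: vectorspace class_ring "span_vs B"
    using span_is_subspace[of B] B subspace_is_vs by simp
  have fin: "VA.fin_dim" "VB.fin_dim"
    using fin_dim_span A B by auto
  obtain b where b: "finite b" "VB.basis b"
    using VB.finite_basis_exists[OF fin(2)] by auto
  then have bB: "b \<subseteq> span B" and li: "VB.lin_indpt b" and gen: "VB.gen_set b"
    by (auto simp: VB.basis_def)
  have bA: "b \<subseteq> span A" using bB sub by auto
  have "VA.lin_indpt b"
    using li span_li_not_depend(2)[OF bB subm(2)] span_li_not_depend(2)[OF bA subm(1)] by simp
  moreover have "card b = VA.dim"
    using VB.dim_basis[OF b] dim by simp
  ultimately have "VA.basis b"
    using fin(1) b(1) bA by (intro VA.dim_li_is_basis) auto
  then have "VA.gen_set b" by (simp add: VA.basis_def)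
  then show ?thesis
    using gen span_li_not_depend(1)[OF bB subm(2)] span_li_not_depend(1)[OF bA subm(1)] by simp
qed

lemma col_space_eq_if_rank_mult_eq:
  assumes A: "A \<in> carrier_mat n nc" and B: "B \<in> carrier_mat nc m"
    and rank: "rank (A * B) = rank A"
  shows "col_space (A * B) = col_space A"
proof -
  have "set (cols A) \<subseteq> carrier_vec n" "set (cols (A * B)) \<subseteq> carrier_vec n"
    using A B cols_dim[of A] cols_dim[of "A * B"] by auto
  then show ?thesis
    unfolding col_space_def
    using col_space_mult_subset[OF A B] rank
    by (intro span_eq_if_subset_dim_eq) (auto simp: rank_def col_space_def)
qed

lemma factor_if_col_space_subset:
  assumes A: "A \<in> carrier_mat n nc" and B: "B \<in> carrier_mat n m"
    and sub: "col_space A \<subseteq> col_space B"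
  shows "\<exists>Y\<in>carrier_mat m nc. A = B * Y"
proof -
  have "\<exists>x\<in>carrier_vec m. B *\<^sub>v x = col A j" if j: "j < nc" for j
  proof -
    have "col A j = A *\<^sub>v unit_vec nc j"
      using A j by (intro eq_vecI) auto
    then have "col A j \<in> col_space A"
      using A j by (auto simp: col_space_eq[OF A])
    then show ?thesis
      using sub B by (auto simp: col_space_eq[OF B])
  qed
  then obtain x where x: "\<And>j. j < nc \<Longrightarrow> x j \<in> carrier_vec m" "\<And>j. j < nc \<Longrightarrow> B *\<^sub>v x j = col A j"
    by metis
  define Y where "Y = mat m nc (\<lambda>(i, j). x j $ i)"
  have "A = B * Y"
  proof (rule eq_matI)
    fix i j assume "i < dim_row (B * Y)" "j < dim_col (B * Y)"
    then have ij: "i < n" "j < nc" using B by (auto simp: Y_def)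
    have "col Y j = x j"
      using x(1)[OF ij(2)] ij by (intro eq_vecI) (auto simp: Y_def)
    then have "(B * Y) $$ (i, j) = (B *\<^sub>v x j) $ i"
      using ij B by (simp add: Y_def)
    then show "A $$ (i, j) = (B * Y) $$ (i, j)"
      using x(2)[OF ij(2)] ij A by simp
  qed (use A B in \<open>auto simp: Y_def\<close>)
  then show ?thesis by (auto simp: Y_def)
qed

end

text \<open>
  Equal ranks of consecutive powers mean equal column spaces. This turns the index, which is
  defined by ranks, into the equation that the algebraic construction of the Drazin inverse
  needs.
\<close>

lemma rank_pow_eq_iff_right_quotient:
  fixes A :: "'a::field mat"
  assumes A: "A \<in> carrier_mat d d"
  shows "vec_space.rank d (A ^\<^sub>m k) = vec_space.rank d (A ^\<^sub>m Suc k)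
    \<longleftrightarrow> (\<exists>Y\<in>carrier_mat d d. A ^\<^sub>m k = A ^\<^sub>m Suc k * Y)"
proof -
  interpret vec_space "TYPE('a)" d .
  have carr: "A ^\<^sub>m k \<in> carrier_mat d d" "A ^\<^sub>m Suc k \<in> carrier_mat d d"
    using A by auto
  show ?thesis
  proof
    assume "rank (A ^\<^sub>m k) = rank (A ^\<^sub>m Suc k)"
    then have "col_space (A ^\<^sub>m Suc k) = col_space (A ^\<^sub>m k)"
      using col_space_eq_if_rank_mult_eq[OF carr(1) A] by simp
    then show "\<exists>Y\<in>carrier_mat d d. A ^\<^sub>m k = A ^\<^sub>m Suc k * Y"
      by (intro factor_if_col_space_subset[OF carr]) simp
  next
    assume "\<exists>Y\<in>carrier_mat d d. A ^\<^sub>m k = A ^\<^sub>m Suc k * Y"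
    then have "col_space (A ^\<^sub>m k) \<subseteq> col_space (A ^\<^sub>m Suc k)"
      using col_space_mult_subset[OF carr(2)] by metis
    moreover have "col_space (A ^\<^sub>m Suc k) \<subseteq> col_space (A ^\<^sub>m k)"
      using col_space_mult_subset[OF carr(1) A] by simp
    ultimately have "span (set (cols (A ^\<^sub>m k))) = span (set (cols (A ^\<^sub>m Suc k)))"
      by (simp add: col_space_def)
    then show "rank (A ^\<^sub>m k) = rank (A ^\<^sub>m Suc k)"
      by (simp add: rank_def)
  qed
qed

section \<open>Integrality of the inverses of the nonzero eigenvalues\<close>

interpretation to_ac_hom: inj_comm_ring_hom "to_ac :: 'a::field \<Rightarrow> 'a alg_closure"
  by unfold_locales auto

lemma monic_char_poly:
  fixes A :: "'a::field mat"
  shows "A \<in> carrier_mat d d \<Longrightarrow> lead_coeff (char_poly A) = 1"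
  using degree_monic_char_poly[of A d] by simp

text \<open>
  The product of the nonzero eigenvalues is, up to the sign \<open>s\<close>, the lowest nonzero coefficient
  of the characteristic polynomial of \<open>A\<close>. So it lies in the base field, and the partial
  inverse in the definition of the pseudo-determinant does return it.
\<close>

lemma to_ac_pdet:
  fixes A :: "'a::field mat"
  assumes A: "A \<in> carrier_mat d d"
  defines "B \<equiv> map_mat to_ac A"
  shows "to_ac (pdet A) = (\<Prod>a | eigenvalue B a \<and> a \<noteq> 0. a ^ order a (char_poly B))"
proof -
  define m where "m = order 0 (char_poly B)"
  define R where "R = {a. eigenvalue B a \<and> a \<noteq> 0}"
  \<comment> \<open>The sign, formed in the base field so that it can be moved there together with the coefficient.\<close>
  define s where "s = (\<Prod>a\<in>R. (-1 :: 'a) ^ order a (char_poly B))"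
  have B: "B \<in> carrier_mat d d" using A by (simp add: B_def)
  have R: "R = {a. poly (char_poly B) a = 0 \<and> a \<noteq> 0}"
    by (simp add: R_def eigenvalue_root_char_poly[OF B])
  have "to_ac (coeff (char_poly A) m) = coeff (char_poly B) m"
    by (simp add: B_def to_ac_hom.char_poly_hom[OF A])
  also have "\<dots> = (\<Prod>a\<in>R. (-a) ^ order a (char_poly B))"
    unfolding m_def R by (rule alg_closed_lowest_coeff(1)[OF monic_char_poly[OF B]])
  also have "\<dots> = to_ac s * (\<Prod>a\<in>R. a ^ order a (char_poly B))"
    by (simp add: s_def to_ac_prod flip: prod.distrib power_mult_distrib)
  finally have "to_ac s * to_ac (coeff (char_poly A) m) = to_ac (s * s) * (\<Prod>a\<in>R. a ^ order a (char_poly B))"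
    by simp
  also have "s * s = 1"
    by (simp add: s_def flip: prod.distrib power_mult_distrib)
  finally have "to_ac (s * coeff (char_poly A) m) = (\<Prod>a\<in>R. a ^ order a (char_poly B))"
    by simp
  then show ?thesis
    unfolding pdet_def Let_def B_def[symmetric] R_def[symmetric]
    by (metis of_ac_to_ac)
qed

text \<open>
  All eigenvalues are algebraic integers because their \<open>n\<close>-th powers are eigenvalues of an
  integral matrix. As the product of the nonzero ones is a unit, the inverse of one of them is
  the product of the others, up to that unit.
\<close>

lemma algebraic_int_inverse_eigenvalue:
  fixes A :: "'a::field_char_0 mat"
  assumes A: "A \<in> carrier_mat d d" and pdet: "pdet A \<in> \<O>\<^sup>\<times>"
    and n: "n > 0" and int: "A ^\<^sub>m n \<in> matrices_over d \<O>"
    and ev: "eigenvalue (map_mat to_ac A) x" "x \<noteq> 0"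
  shows "algebraic_int (inverse x)"
proof -
  define B where "B = map_mat to_ac A"
  define R where "R = {a. eigenvalue B a \<and> a \<noteq> 0}"
  define e where "e a = order a (char_poly B)" for a
  have B: "B \<in> carrier_mat d d" using A by (simp add: B_def)
  have p0: "char_poly B \<noteq> 0" using monic_char_poly[OF B] by auto
  have R: "R = {a. poly (char_poly B) a = 0 \<and> a \<noteq> 0}"
    by (simp add: R_def eigenvalue_root_char_poly[OF B])
  have fin: "finite R"
    unfolding R by (rule finite_subset[OF _ poly_roots_finite[OF p0]]) auto
  have eig_int: "algebraic_int a" if "eigenvalue B a" for a
  proof -
    have "eigenvalue (B ^\<^sub>m n) (a ^ n)"
      using that eigenvector_pow[OF B] B unfolding eigenvalue_def eigenvector_def by auto
    moreover have Bn: "B ^\<^sub>m n = map_mat to_ac (A ^\<^sub>m n)"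
      unfolding B_def by (rule to_ac_hom.mat_hom_pow[OF A, symmetric])
    ultimately have "eigenvalue (map_mat to_ac (A ^\<^sub>m n)) (a ^ n)"
      by simp
    then have "algebraic_int (a ^ n)"
    proof (rule algebraic_int_eigenvalue[rotated])
      show "map_mat to_ac (A ^\<^sub>m n) \<in> matrices_over d \<O>"
        using int carrier_matD[OF pow_carrier_mat[OF A, of n]]
        by (simp add: matrices_over_integers_iff algebraic_int_to_ac_iff)
    qed
    then show ?thesis
      by (rule algebraic_int_root[of _ "monom 1 n"])
        (use n in \<open>auto simp: poly_monom degree_monom_eq\<close>)
  qed
  obtain y where y: "algebraic_int y" "pdet A * y = 1"
    using pdet by (auto simp: integer_units_def ring_of_integers_def)
  have x: "x \<in> R" using ev by (simp add: R_def B_def)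
  have "e x > 0"
    using x p0 by (simp add: e_def R order_gt_0_iff)
  have "(\<Prod>a\<in>R. a ^ e a) = x ^ e x * (\<Prod>a\<in>R - {x}. a ^ e a)"
    using fin x by (rule prod.remove)
  also have "x ^ e x = x * x ^ (e x - 1)"
    using \<open>e x > 0\<close> by (simp flip: power_Suc)
  finally have "x * (x ^ (e x - 1) * (\<Prod>a\<in>R - {x}. a ^ e a) * to_ac y) = (\<Prod>a\<in>R. a ^ e a) * to_ac y"
    by (simp only: mult.assoc)
  also have "(\<Prod>a\<in>R. a ^ e a) = to_ac (pdet A)"
    unfolding to_ac_pdet[OF A] B_def R_def e_def ..
  also have "to_ac (pdet A) * to_ac y = 1"
    unfolding to_ac_mult[symmetric] y(2) by (rule to_ac_1)
  finally have "inverse x = x ^ (e x - 1) * (\<Prod>a\<in>R - {x}. a ^ e a) * to_ac y"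
    by (rule inverse_unique)
  also have "algebraic_int \<dots>"
    using eig_int x y(1)
    by (intro algebraic_int_times algebraic_int_power algebraic_int_prod)
      (auto simp: R_def algebraic_int_to_ac_iff)
  finally show ?thesis .
qed

text \<open>
  Up to sign the lowest nonzero coefficient is the product of the nonzero eigenvalues of
  \<open>A ^ n\<close>, and these are \<open>n\<close>-th powers of eigenvalues of \<open>A\<close>.
\<close>

lemma lowest_coeff_char_poly_pow_unit:
  fixes A :: "'a::field_char_0 mat"
  assumes A: "A \<in> carrier_mat d d" and pdet: "pdet A \<in> \<O>\<^sup>\<times>"
    and n: "n > 0" and int: "A ^\<^sub>m n \<in> matrices_over d \<O>"
  obtains m where "\<And>i. i < m \<Longrightarrow> coeff (char_poly (A ^\<^sub>m n)) i = 0"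
    "coeff (char_poly (A ^\<^sub>m n)) m \<noteq> 0"
    "algebraic_int (inverse (coeff (char_poly (A ^\<^sub>m n)) m))"
proof -
  define B where "B = map_mat to_ac A"
  define p where "p = char_poly (B ^\<^sub>m n)"
  have B: "B \<in> carrier_mat d d" and Bn: "B ^\<^sub>m n \<in> carrier_mat d d" and An: "A ^\<^sub>m n \<in> carrier_mat d d"
    using A by (simp_all add: B_def)
  have "B ^\<^sub>m n = map_mat to_ac (A ^\<^sub>m n)"
    unfolding B_def by (rule to_ac_hom.mat_hom_pow[OF A, symmetric])
  then have coeff_p: "coeff p i = to_ac (coeff (char_poly (A ^\<^sub>m n)) i)" for i
    by (simp add: p_def to_ac_hom.char_poly_hom[OF An])
  have monic: "lead_coeff p = 1"
    unfolding p_def by (rule monic_char_poly[OF Bn])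
  have inv: "algebraic_int (inverse a)" if "poly p a = 0" "a \<noteq> 0" for a
  proof -
    have "eigenvalue (B ^\<^sub>m n) a"
      using that(1) by (simp add: p_def eigenvalue_root_char_poly[OF Bn])
    then obtain b where b: "eigenvalue B b" "b ^ n = a"
      using eigenvalue_pow_imp_eigenvalue[OF B n] by auto
    have "algebraic_int (inverse b)"
      using A pdet n int
    proof (rule algebraic_int_inverse_eigenvalue)
      show "eigenvalue (map_mat to_ac A) b" "b \<noteq> 0"
        using b that n by (auto simp: B_def)
    qed
    then show ?thesis
      using algebraic_int_power[of "inverse b" n] by (simp add: power_inverse b(2))
  qed
  have low: "coeff p (order 0 p) = (\<Prod>a | poly p a = 0 \<and> a \<noteq> 0. (-a) ^ order a p)"
    by (rule alg_closed_lowest_coeff(1)[OF monic])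
  have "to_ac (inverse (coeff (char_poly (A ^\<^sub>m n)) (order 0 p))) = inverse (coeff p (order 0 p))"
    by (simp add: coeff_p)
  also have "\<dots> = (\<Prod>a | poly p a = 0 \<and> a \<noteq> 0. (- inverse a) ^ order a p)"
    unfolding low prod_inversef[symmetric]
    by (intro prod.cong) (simp_all flip: power_inverse)
  also have "algebraic_int \<dots>"
    using inv by (intro algebraic_int_prod algebraic_int_power) auto
  finally have int_inv: "algebraic_int (inverse (coeff (char_poly (A ^\<^sub>m n)) (order 0 p)))"
    by (simp only: algebraic_int_to_ac_iff)
  show ?thesis
  proof (rule that[OF _ _ int_inv])
    show "coeff (char_poly (A ^\<^sub>m n)) i = 0" if "i < order 0 p" for i
      using alg_closed_lowest_coeff(2)[OF monic that] by (simp add: coeff_p)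
    have "p \<noteq> 0" using monic by auto
    then have "finite {a. poly p a = 0 \<and> a \<noteq> 0}"
      by (intro finite_subset[OF _ poly_roots_finite[of p]]) auto
    then have "coeff p (order 0 p) \<noteq> 0"
      unfolding low by auto
    then show "coeff (char_poly (A ^\<^sub>m n)) (order 0 p) \<noteq> 0"
      by (simp add: coeff_p)
  qed
qed

section \<open>The Drazin inverse of a matrix\<close>

text \<open>
  The matrix \<open>V = - C / c\<close>, where \<open>c\<close> is the lowest nonzero coefficient of the characteristic
  polynomial and \<open>C\<close> the coefficient of the adjugate in the same degree.
\<close>

lemma pow_left_quotient:
  fixes A :: "'a::field_char_0 mat"
  assumes A: "A \<in> carrier_mat d d"
    and low: "\<And>i. i < m \<Longrightarrow> coeff (char_poly A) i = 0" and c: "coeff (char_poly A) m \<noteq> 0"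
  obtains V where "V \<in> carrier_mat d d" "V * A = A * V" "A ^\<^sub>m m = V * A ^\<^sub>m Suc m"
    "A \<in> matrices_over d \<O> \<Longrightarrow> algebraic_int (inverse (coeff (char_poly A) m)) \<Longrightarrow>
       V \<in> matrices_over d \<O>"
proof -
  define c where "c = coeff (char_poly A) m"
  obtain C where C: "C \<in> carrier_mat d d" "C * A = A * C"
    "(C * A + c \<cdot>\<^sub>m 1\<^sub>m d) * A ^\<^sub>m m = 0\<^sub>m d d"
    "A \<in> matrices_over d \<O> \<Longrightarrow> C \<in> matrices_over d \<O>"
    using adjugate_annihilates_power[OF A low] unfolding c_def by metis
  define V where "V = (- inverse c) \<cdot>\<^sub>m C"
  have pow: "A ^\<^sub>m m \<in> carrier_mat d d" "A ^\<^sub>m Suc m \<in> carrier_mat d d"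
    using A by auto
  have "(C * A + c \<cdot>\<^sub>m 1\<^sub>m d) * A ^\<^sub>m m = C * A * A ^\<^sub>m m + c \<cdot>\<^sub>m 1\<^sub>m d * A ^\<^sub>m m"
    using A C(1) pow by (intro add_mult_distrib_mat[of _ d d _ _ d]) auto
  also have "C * A * A ^\<^sub>m m = C * A ^\<^sub>m Suc m"
    unfolding pow_mat_Suc_left[OF A] by (rule assoc_mult_mat[OF C(1) A pow(1)])
  also have "c \<cdot>\<^sub>m 1\<^sub>m d * A ^\<^sub>m m = c \<cdot>\<^sub>m A ^\<^sub>m m"
    using left_mult_one_mat[OF pow(1)] mult_smult_assoc_mat[OF one_carrier_mat pow(1), of c] by simp
  finally have sum0: "C * A ^\<^sub>m Suc m + c \<cdot>\<^sub>m A ^\<^sub>m m = 0\<^sub>m d d"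
    using C(3) by simp
  have VA: "V * A ^\<^sub>m Suc m = (- inverse c) \<cdot>\<^sub>m (C * A ^\<^sub>m Suc m)"
    unfolding V_def using C(1) pow(2) by (rule mult_smult_assoc_mat)
  have CA: "C * A ^\<^sub>m Suc m \<in> carrier_mat d d"
    using C(1) pow(2) by (rule mult_carrier_mat)
  have "A ^\<^sub>m m = V * A ^\<^sub>m Suc m"
  proof (rule eq_matI)
    fix i j assume "i < dim_row (V * A ^\<^sub>m Suc m)" "j < dim_col (V * A ^\<^sub>m Suc m)"
    then have ij: "i < d" "j < d" using C(1) A by (auto simp: V_def)
    have "(C * A ^\<^sub>m Suc m) $$ (i, j) + c * (A ^\<^sub>m m) $$ (i, j) = 0"
      using arg_cong[OF sum0, of "\<lambda>M. M $$ (i, j)"] ij carrier_matD[OF CA] carrier_matD[OF pow(1)]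
      by (simp del: pow_mat.simps index_mult_mat)
    then have "(C * A ^\<^sub>m Suc m) $$ (i, j) = - c * (A ^\<^sub>m m) $$ (i, j)"
      by (simp add: eq_neg_iff_add_eq_0 del: pow_mat.simps index_mult_mat)
    moreover have "c \<noteq> 0" using c by (simp add: c_def)
    ultimately show "(A ^\<^sub>m m) $$ (i, j) = (V * A ^\<^sub>m Suc m) $$ (i, j)"
      unfolding VA using ij carrier_matD[OF CA] by (simp add: field_simps del: pow_mat.simps index_mult_mat)
  qed (use C(1) A in \<open>auto simp: V_def\<close>)
  moreover have "V * A = A * V"
    using C(1,2) A by (simp add: V_def mult_smult_assoc_mat[of _ d d] mult_smult_distrib[of _ d d])
  moreover have "V \<in> matrices_over d \<O>"
    if "A \<in> matrices_over d \<O>" "algebraic_int (inverse c)"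
    using that C(1,4) unfolding matrices_over_integers_iff V_def
    by (auto intro!: algebraic_int_times)
  moreover have "V \<in> carrier_mat d d" using C(1) by (simp add: V_def)
  ultimately show ?thesis using that unfolding c_def by blast
qed

lemma ex_lowest_coeff:
  fixes p :: "'a::zero poly"
  assumes "p \<noteq> 0"
  obtains m where "\<And>i. i < m \<Longrightarrow> coeff p i = 0" "coeff p m \<noteq> 0"
proof (rule that)
  have ex: "\<exists>m. coeff p m \<noteq> 0" using assms by (metis leading_coeff_neq_0)
  show "coeff p (LEAST m. coeff p m \<noteq> 0) \<noteq> 0" using LeastI_ex[OF ex] .
  show "coeff p i = 0" if "i < (LEAST m. coeff p m \<noteq> 0)" for i
    using not_less_Least[OF that] by simp
qed

lemma mat_pow_commutes:
  fixes A V :: "'a::comm_ring_1 mat"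
  assumes V: "V \<in> carrier_mat d d" and A: "A \<in> carrier_mat d d" and comm: "V * A = A * V"
  shows "V * A ^\<^sub>m k = A ^\<^sub>m k * V"
proof -
  interpret semiring "ring_mat TYPE('a) d ()" by (rule semiring_mat)
  show ?thesis
    using group_commutes_pow[of A V k, unfolded ring_mat_simps pow_mat_ring_pow[OF A, symmetric]]
      comm A V by simp
qed

text \<open>
  If \<open>A\<close> is singular, the index is a least number, and the point is that the set over which it
  is taken is nonempty: the left quotient commutes with \<open>A\<close>, so it is also a right quotient, and
  the ranks agree from some power on.
\<close>

lemma mat_index_right_quotient:
  fixes A :: "'a::field_char_0 mat"
  assumes A: "A \<in> carrier_mat d d"
  shows "\<exists>Y\<in>carrier_mat d d. A ^\<^sub>m mat_index A = A ^\<^sub>m Suc (mat_index A) * Y"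
proof (cases "invertible_mat A")
  case True
  then obtain Y where Y: "A * Y = 1\<^sub>m d" "Y * A = 1\<^sub>m (dim_row Y)"
    using A by (auto simp: invertible_mat_def inverts_mat_def)
  have "dim_col Y = d" "dim_row Y = d"
    using arg_cong[OF Y(1), of dim_col] arg_cong[OF Y(2), of dim_col] A by auto
  then show ?thesis
    using Y(1) A True by (intro bexI[of _ Y]) (auto simp: mat_index_def)
next
  case False
  have "char_poly A \<noteq> 0"
    using monic_char_poly[OF A] by auto
  then obtain m where m: "\<And>i. i < m \<Longrightarrow> coeff (char_poly A) i = 0" "coeff (char_poly A) m \<noteq> 0"
    using ex_lowest_coeff by metis
  obtain V where V: "V \<in> carrier_mat d d" "V * A = A * V" "A ^\<^sub>m m = V * A ^\<^sub>m Suc m"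
    using pow_left_quotient[OF A m] by metis
  have pow: "A ^\<^sub>m Suc m \<in> carrier_mat d d" by (rule pow_carrier_mat[OF A])
  have comm: "V * A ^\<^sub>m k = A ^\<^sub>m k * V" for k
    using mat_pow_commutes[OF V(1) A V(2), of k] .
  \<comment> \<open>The exponent \<open>Suc m\<close> instead of \<open>m\<close>, since the index of a singular matrix is positive by
    definition while \<open>m\<close> could be zero.\<close>
  have "A ^\<^sub>m Suc m = A ^\<^sub>m m * A"
    by simp
  also have "A ^\<^sub>m m = A ^\<^sub>m Suc m * V"
    unfolding comm[symmetric] by (rule V(3))
  also have "A ^\<^sub>m Suc m * V * A = A ^\<^sub>m Suc m * (A * V)"
    unfolding V(2)[symmetric] by (rule assoc_mult_mat[OF pow V(1) A])
  also have "\<dots> = A ^\<^sub>m Suc m * A * V"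
    by (rule assoc_mult_mat[OF pow A V(1), symmetric])
  also have "A ^\<^sub>m Suc m * A = A ^\<^sub>m Suc (Suc m)"
    by simp
  finally have "\<exists>Y\<in>carrier_mat d d. A ^\<^sub>m Suc m = A ^\<^sub>m Suc (Suc m) * Y"
    using V(1) by blast
  then have "0 < Suc m \<and> vec_space.rank d (A ^\<^sub>m Suc m) = vec_space.rank d (A ^\<^sub>m (Suc m + 1))"
    using rank_pow_eq_iff_right_quotient[OF A, of "Suc m"] by simp
  then have "vec_space.rank d (A ^\<^sub>m mat_index A) = vec_space.rank d (A ^\<^sub>m (mat_index A + 1))"
    using LeastI[of "\<lambda>k. 0 < k \<and> vec_space.rank d (A ^\<^sub>m k) = vec_space.rank d (A ^\<^sub>m (k + 1))" "Suc m"]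
      False A by (simp add: mat_index_def del: pow_mat.simps)
  then show ?thesis
    using rank_pow_eq_iff_right_quotient[OF A, of "mat_index A"] by simp
qed

text \<open>
  The definite description in the definition of \<^const>\<open>drazin_inverse\<close> is meaningful: the left
  quotient from the adjugate and the right quotient from the index give existence.
\<close>

lemma is_drazin_inverse_drazin_inverse:
  fixes A :: "'a::field_char_0 mat"
  assumes A: "A \<in> carrier_mat d d"
  shows "is_drazin_inverse A (drazin_inverse A)"
proof -
  let ?G = "ring_mat TYPE('a) d ()"
  interpret semiring ?G by (rule semiring_mat)
  have pow: "A ^\<^sub>m k = A [^]\<^bsub>?G\<^esub> k" for k
    by (rule pow_mat_ring_pow[OF A])
  have "char_poly A \<noteq> 0"
    using monic_char_poly[OF A] by auto
  then obtain m where m: "\<And>i. i < m \<Longrightarrow> coeff (char_poly A) i = 0" "coeff (char_poly A) m \<noteq> 0"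
    using ex_lowest_coeff by metis
  obtain V where V: "V \<in> carrier_mat d d" "V * A = A * V" "A ^\<^sub>m m = V * A ^\<^sub>m Suc m"
    using pow_left_quotient[OF A m] by metis
  obtain Y where Y: "Y \<in> carrier_mat d d" "A ^\<^sub>m mat_index A = A ^\<^sub>m Suc (mat_index A) * Y"
    using mat_index_right_quotient[OF A] by blast
  note exists = drazin_exists[of A V m Y "mat_index A", unfolded ring_mat_simps pow[symmetric]]
  note unique = drazin_unique[of A _ "mat_index A", unfolded ring_mat_simps pow[symmetric]]
  have "\<exists>D\<in>carrier_mat d d. A * D = D * A \<and> D * A * D = D \<and>
      A * D * A ^\<^sub>m mat_index A = A ^\<^sub>m mat_index A"
    using A V Y by (rule exists)
  then have "\<exists>D. is_drazin_inverse A D"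
    using A by (auto simp: is_drazin_inverse_def)
  moreover have "D = D'" if "is_drazin_inverse A D" "is_drazin_inverse A D'" for D D'
  proof -
    have D: "E \<in> carrier_mat d d" "A * E = E * A" "E * A * E = E"
      "A * E * A ^\<^sub>m mat_index A = A ^\<^sub>m mat_index A" if "is_drazin_inverse A E" for E
      using that A unfolding is_drazin_inverse_def by auto
    show ?thesis
      by (rule unique[OF A D D]) (fact that)+
  qed
  ultimately have "\<exists>!D. is_drazin_inverse A D" by blast
  then show ?thesis
    unfolding drazin_inverse_def by (rule theI')
qed

section \<open>Integral powers of the core part\<close>

theorem theorem5p1:
  fixes A T :: "'k::field_char_0 mat" and d :: nat
  assumes "number_field TYPE('k)"
    and "d \<ge> 1"
    and "A \<in> carrier_mat d d"
    and "pdet A \<in> \<O>\<^sup>\<times>"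
    and "T = A ^\<^sub>m 2 * drazin_inverse A"
  shows "exponent_semigroup A \<subseteq> exponent_semigroup T"
proof
  fix n assume n: "n \<in> exponent_semigroup A"
  note A = assms(3)
  let ?G = "ring_mat TYPE('k) d ()"
  interpret semiring ?G by (rule semiring_mat)
  define D where "D = drazin_inverse A"
  have pow: "M [^]\<^bsub>?G\<^esub> i = M ^\<^sub>m i" if "M \<in> carrier_mat d d" for M :: "'k mat" and i :: nat
    by (rule pow_mat_ring_pow[OF that, symmetric])
  have D: "D \<in> carrier_mat d d" "A * D = D * A" "D * A * D = D"
    "A * D * A ^\<^sub>m mat_index A = A ^\<^sub>m mat_index A"
    using is_drazin_inverse_drazin_inverse[OF A] A by (auto simp: is_drazin_inverse_def D_def)
  have T: "T = A * (A * D)"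
    unfolding assms(5) D_def[symmetric] using A D(1)
    by (simp add: numeral_2_eq_2 assoc_mult_mat[of A d d A d D d])
  have T_carrier: "T \<in> carrier_mat d d" unfolding T using A D(1) by auto
  have An: "A ^\<^sub>m n \<in> matrices_over d \<O>"
    using n A by (simp add: exponent_semigroup_def)
  \<comment> \<open>The formula \<open>T ^ n = A ^ n * (A * D)\<close> fails for \<open>n = 0\<close>, where both powers are the identity.\<close>
  have "T ^\<^sub>m n \<in> matrices_over d \<O>"
  proof (cases "n = 0")
    case True
    then show ?thesis using An A T_carrier by simp
  next
    case False
    then have n0: "n > 0" by simp
    define B where "B = A ^\<^sub>m n"
    have B: "B \<in> carrier_mat d d" using A by (simp add: B_def)
    obtain m where m: "\<And>i. i < m \<Longrightarrow> coeff (char_poly B) i = 0" "coeff (char_poly B) m \<noteq> 0"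
      "algebraic_int (inverse (coeff (char_poly B) m))"
      using lowest_coeff_char_poly_pow_unit[OF A assms(4) n0 An] unfolding B_def by metis
    obtain V where V: "V \<in> matrices_over d \<O>" "B ^\<^sub>m m = V * B ^\<^sub>m Suc m"
      using pow_left_quotient[OF B m(1,2)] An m(3) unfolding B_def by metis
    have V_carrier: "V \<in> carrier_mat d d" using V(1) by (simp add: matrices_over_integers_iff)
    have "A * D = V ^\<^sub>m mat_index A * B ^\<^sub>m mat_index A"
      unfolding B_def
      by (rule drazin_projection_eq[of A D "mat_index A" n V m,
            unfolded ring_mat_simps pow[OF A] pow[OF B[unfolded B_def]] pow[OF V_carrier]])
        (use A D V_carrier n0 V(2) in \<open>auto simp only: B_def\<close>)
    then have AD: "A * D \<in> matrices_over d \<O>"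
      using V(1) An by (auto simp: B_def intro!: matrices_over_integers_mult matrices_over_integers_pow)
    obtain i where i: "n = Suc i" using n0 by (cases n) auto
    have AD_carrier: "A * D \<in> carrier_mat d d" using A D(1) by simp
    have "(A * D) ^\<^sub>m n = A * D"
      using drazin_projection_pow(1)[of A D i, unfolded ring_mat_simps pow[OF AD_carrier]] A D(1-3)
      unfolding i by simp
    moreover have "A * (A * D) = A * D * A"
      using drazin_projection_comm[of A D 1, unfolded ring_mat_simps pow[OF A]] A D(1,2) by simp
    then have "T ^\<^sub>m n = A ^\<^sub>m n * (A * D) ^\<^sub>m n"
      using pow_mult_distrib[of A "A * D" n,
          unfolded ring_mat_simps pow[OF A] pow[OF AD_carrier] pow[OF T_carrier[unfolded T]]]
        A AD_carrier unfolding T by simp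
    ultimately show ?thesis
      using matrices_over_integers_mult[OF An AD] by simp
  qed
  then show "n \<in> exponent_semigroup T"
    using T_carrier by (simp add: exponent_semigroup_def)
qed

end
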